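(* Let $S$ and $S'$ be semirings and let $\varphi\colon S\to S'$ be a semiring homomorphism. If $J$ is a $k$-prime ideal of $S'$, then its $k$-contraction $J^c:=\varphi^{-1}(J)$ is a $k$-prime ideal of $S$.
   Context: A semiring is a commutative semiring $(S,+,0,\cdot,1)$ with multiplicative identity $1$ and additive identity $0$ that is absorbing. Semiring homomorphisms preserve $+,\cdot,0,1$. An ideal is a nonempty subset closed under addition and under multiplication by elements of $S$. A $k$-ideal is an ideal $I$ such that $x+y\in I$ and $y\in I$ imply $x\in I$. A $k$-ideal $I$ is $k$-prime if for all $k$-ideals $A,B$ of the semiring, $AB\subseteq I$ implies $A\subseteq I$ or $B\subseteq I$, where $AB$ is the ideal of finite sums of products $ab$ with $a\in A$, $b\in B$. *)

theory Defs
  imports "HOL-Algebra.Ideal_Product"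
begin

(* As in the locale cring, no distinctness of zero and one is assumed. *)
locale csemiring = semiring R + comm_monoid R for R (structure)

(* Without additive inverses, preservation of zero does not follow from membership
   in ring_hom, so it is required separately. *)
definition semiring_hom ::
    "('a, 'm) ring_scheme \<Rightarrow> ('b, 'n) ring_scheme \<Rightarrow> ('a \<Rightarrow> 'b) set" where
  "semiring_hom R S = {h \<in> ring_hom R S. h \<zero>\<^bsub>R\<^esub> = \<zero>\<^bsub>S\<^esub>}"

(* The library's locale ideal presupposes a ring, hence this notion for semirings. *)
definition semiring_ideal :: "'a set \<Rightarrow> ('a, 'm) ring_scheme \<Rightarrow> bool" where
  "semiring_ideal I R \<longleftrightarrow>
     I \<subseteq> carrier R \<and> I \<noteq> {} \<and>
     (\<forall>x\<in>I. \<forall>y\<in>I. x \<oplus>\<^bsub>R\<^esub> y \<in> I) \<and>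
     (\<forall>r\<in>carrier R. \<forall>x\<in>I. r \<otimes>\<^bsub>R\<^esub> x \<in> I)"

definition k_ideal :: "'a set \<Rightarrow> ('a, 'm) ring_scheme \<Rightarrow> bool" where
  "k_ideal I R \<longleftrightarrow>
     semiring_ideal I R \<and>
     (\<forall>x\<in>carrier R. \<forall>y\<in>carrier R. x \<oplus>\<^bsub>R\<^esub> y \<in> I \<longrightarrow> y \<in> I \<longrightarrow> x \<in> I)"

(* The product is the library's ideal_prod, the set of finite sums of products a b,
   whose definition does not depend on R being a ring.  A k-prime ideal is not
   required to be proper. *)
definition k_prime_ideal :: "'a set \<Rightarrow> ('a, 'm) ring_scheme \<Rightarrow> bool" where
  "k_prime_ideal I R \<longleftrightarrow>
     k_ideal I R \<and>
     (\<forall>A B. k_ideal A R \<longrightarrow> k_ideal B R \<longrightarrow>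
        A \<cdot>\<^bsub>R\<^esub> B \<subseteq> I \<longrightarrow> A \<subseteq> I \<or> B \<subseteq> I)"

definition k_contraction ::
    "('a, 'm) ring_scheme \<Rightarrow> ('a \<Rightarrow> 'b) \<Rightarrow> 'b set \<Rightarrow> 'a set" where
  "k_contraction R h J = {x \<in> carrier R. h x \<in> J}"

end

theory Submission
  imports Defs
begin

text \<open>
  A \<open>k\<close>-prime ideal \<open>J\<close> of a commutative semiring is prime on elements. Indeed, the \<open>k\<close>-ideal
  generated by \<open>a\<close> consists of all \<open>x\<close> with \<open>x + r a = s a\<close> for some \<open>r\<close> and \<open>s\<close>. If
  \<open>a b \<in> J\<close>, two applications of the subtractive property show that the product of the \<open>k\<close>-ideals
  generated by \<open>a\<close> and \<open>b\<close> lies in \<open>J\<close>. Elementwise primeness passes to preimages, and it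
  implies \<open>k\<close>-primeness.
\<close>

lemma semiring_idealD:
  assumes "semiring_ideal I R"
  shows "I \<subseteq> carrier R" "I \<noteq> {}"
    "\<And>x y. x \<in> I \<Longrightarrow> y \<in> I \<Longrightarrow> x \<oplus>\<^bsub>R\<^esub> y \<in> I"
    "\<And>r x. r \<in> carrier R \<Longrightarrow> x \<in> I \<Longrightarrow> r \<otimes>\<^bsub>R\<^esub> x \<in> I"
  using assms by (auto simp: semiring_ideal_def)

lemma k_idealD:
  assumes "k_ideal I R"
  shows "semiring_ideal I R"
    "\<And>x y. x \<in> carrier R \<Longrightarrow> y \<in> carrier R \<Longrightarrow> x \<oplus>\<^bsub>R\<^esub> y \<in> I \<Longrightarrow> y \<in> I \<Longrightarrow> x \<in> I"
  using assms by (auto simp: k_ideal_def)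

lemma ideal_prod_subset_semiring_ideal:
  assumes "semiring_ideal I R" "\<And>x y. x \<in> A \<Longrightarrow> y \<in> B \<Longrightarrow> x \<otimes>\<^bsub>R\<^esub> y \<in> I"
  shows "A \<cdot>\<^bsub>R\<^esub> B \<subseteq> I"
proof
  fix z assume "z \<in> A \<cdot>\<^bsub>R\<^esub> B"
  then show "z \<in> I"
    by (induction rule: ideal_prod.induct) (use assms in \<open>auto simp: semiring_ideal_def\<close>)
qed

text \<open>If neither \<open>A\<close> nor \<open>B\<close> lay in \<open>I\<close>, then some
  \<open>a\<close> in \<open>A\<close> and \<open>b\<close> in \<open>B\<close> would both lie
  outside \<open>I\<close>, although their product belongs to the product of \<open>A\<close> and
  \<open>B\<close> and hence to \<open>I\<close>.\<close>

lemma k_prime_idealI: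
  assumes "k_ideal I R"
    and prime: "\<And>a b. a \<in> carrier R \<Longrightarrow> b \<in> carrier R \<Longrightarrow> a \<otimes>\<^bsub>R\<^esub> b \<in> I \<Longrightarrow> a \<in> I \<or> b \<in> I"
  shows "k_prime_ideal I R"
  unfolding k_prime_ideal_def
proof (intro conjI allI impI)
  fix A B
  assume A: "k_ideal A R" and B: "k_ideal B R" and AB: "A \<cdot>\<^bsub>R\<^esub> B \<subseteq> I"
  have "a \<in> I \<or> b \<in> I" if "a \<in> A" "b \<in> B" for a b
  proof (rule prime)
    show "a \<in> carrier R" "b \<in> carrier R"
      using that semiring_idealD(1) k_idealD(1) A B by blast+
    show "a \<otimes>\<^bsub>R\<^esub> b \<in> I"
      using AB ideal_prod.prod[OF that] by blast
  qed
  then show "A \<subseteq> I \<or> B \<subseteq> I" by blast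
qed (fact assms(1))

text \<open>The subtractive closure of the ideal of multiples of \<open>a\<close>. The equation
  stands for \<open>x = (s - r) a\<close>, with the negative term moved to the other side because
  additive inverses may be absent.\<close>

definition principal_k_ideal :: "('a, 'm) ring_scheme \<Rightarrow> 'a \<Rightarrow> 'a set" where
  "principal_k_ideal R a =
     {x \<in> carrier R. \<exists>r\<in>carrier R. \<exists>s\<in>carrier R. x \<oplus>\<^bsub>R\<^esub> r \<otimes>\<^bsub>R\<^esub> a = s \<otimes>\<^bsub>R\<^esub> a}"

lemma principal_k_idealI:
  assumes "x \<in> carrier R" "r \<in> carrier R" "s \<in> carrier R" "x \<oplus>\<^bsub>R\<^esub> r \<otimes>\<^bsub>R\<^esub> a = s \<otimes>\<^bsub>R\<^esub> a"
  shows "x \<in> principal_k_ideal R a"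
  using assms by (auto simp: principal_k_ideal_def)

lemma principal_k_idealE:
  assumes "x \<in> principal_k_ideal R a"
  obtains r s where "x \<in> carrier R" "r \<in> carrier R" "s \<in> carrier R"
    "x \<oplus>\<^bsub>R\<^esub> r \<otimes>\<^bsub>R\<^esub> a = s \<otimes>\<^bsub>R\<^esub> a"
  using assms by (auto simp: principal_k_ideal_def)

context csemiring
begin

lemma generator_in_principal_k_ideal:
  assumes "a \<in> carrier R"
  shows "a \<in> principal_k_ideal R a"
  \<comment> \<open>The witnesses reflect \<open>a + 0 a = 1 a\<close>.\<close>
  by (rule principal_k_idealI[of _ _ \<zero> \<one>]) (use assms in auto)

lemma k_ideal_principal_k_ideal:
  assumes a: "a \<in> carrier R"
  shows "k_ideal (principal_k_ideal R a) R"
  unfolding k_ideal_def semiring_ideal_def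
proof (intro conjI ballI impI)
  show "principal_k_ideal R a \<subseteq> carrier R" by (auto simp: principal_k_ideal_def)
  show "principal_k_ideal R a \<noteq> {}" using generator_in_principal_k_ideal[OF a] by auto
next
  fix x y assume "x \<in> principal_k_ideal R a" "y \<in> principal_k_ideal R a"
  then obtain r s t u where c: "x \<in> carrier R" "r \<in> carrier R" "s \<in> carrier R"
      "y \<in> carrier R" "t \<in> carrier R" "u \<in> carrier R"
    and e: "x \<oplus> r \<otimes> a = s \<otimes> a" "y \<oplus> t \<otimes> a = u \<otimes> a"
    by (elim principal_k_idealE)
  have "(x \<oplus> y) \<oplus> (r \<oplus> t) \<otimes> a = (x \<oplus> r \<otimes> a) \<oplus> (y \<oplus> t \<otimes> a)"
    using a c by (simp add: l_distr a_ac)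
  also have "\<dots> = (s \<oplus> u) \<otimes> a" unfolding e using a c by (simp add: l_distr)
  finally show "x \<oplus> y \<in> principal_k_ideal R a"
    using c by (intro principal_k_idealI[of _ _ "r \<oplus> t" "s \<oplus> u"]) auto
next
  fix q x assume q: "q \<in> carrier R" and "x \<in> principal_k_ideal R a"
  then obtain r s where c: "x \<in> carrier R" "r \<in> carrier R" "s \<in> carrier R"
    and e: "x \<oplus> r \<otimes> a = s \<otimes> a"
    by (elim principal_k_idealE)
  have "q \<otimes> x \<oplus> (q \<otimes> r) \<otimes> a = q \<otimes> (x \<oplus> r \<otimes> a)"
    using a c q by (simp add: r_distr m_assoc)
  also have "\<dots> = (q \<otimes> s) \<otimes> a" unfolding e using a c q by (simp add: m_assoc)
  finally show "q \<otimes> x \<in> principal_k_ideal R a"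
    using c q by (intro principal_k_idealI[of _ _ "q \<otimes> r" "q \<otimes> s"]) auto
next
  fix x y assume x: "x \<in> carrier R"
    and "x \<oplus> y \<in> principal_k_ideal R a" "y \<in> principal_k_ideal R a"
  then obtain r s t u where c: "r \<in> carrier R" "s \<in> carrier R"
      "y \<in> carrier R" "t \<in> carrier R" "u \<in> carrier R"
    and e: "(x \<oplus> y) \<oplus> r \<otimes> a = s \<otimes> a" "y \<oplus> t \<otimes> a = u \<otimes> a"
    by (elim principal_k_idealE)
  \<comment> \<open>Here \<open>y\<close> has to be eliminated from the two equations. Adding
    \<open>u a = y + t a\<close> to \<open>x\<close> supplies the \<open>y\<close> needed to form
    \<open>x + y + r a\<close>, which equals \<open>s a\<close>; the term \<open>t a\<close> is left
    over. This yields the witnesses \<open>u + r\<close> and \<open>s + t\<close>.\<close>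
  have "x \<oplus> (u \<oplus> r) \<otimes> a = x \<oplus> (y \<oplus> t \<otimes> a) \<oplus> r \<otimes> a"
    unfolding e(2) using a c x by (simp add: l_distr a_assoc)
  also have "\<dots> = ((x \<oplus> y) \<oplus> r \<otimes> a) \<oplus> t \<otimes> a"
    using a c x by (simp add: a_ac)
  also have "\<dots> = (s \<oplus> t) \<otimes> a" unfolding e(1) using a c by (simp add: l_distr)
  finally show "x \<in> principal_k_ideal R a"
    using c x by (intro principal_k_idealI[of _ _ "u \<oplus> r" "s \<oplus> t"]) auto
qed

text \<open>Multiplying \<open>x + r a = s a\<close> by \<open>b\<close> gives
  \<open>b x + b (r a) = b (s a)\<close>. Both \<open>b (r a)\<close> and \<open>b (s a)\<close> are
  multiples of \<open>b a\<close> and so lie in \<open>J\<close>; subtractivity of \<open>J\<close>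
  then puts \<open>b x\<close> there.\<close>

lemma principal_k_ideal_mult_mem:
  assumes J: "k_ideal J R" and a: "a \<in> carrier R" and b: "b \<in> carrier R"
    and x: "x \<in> principal_k_ideal R a" and ba: "b \<otimes> a \<in> J"
  shows "b \<otimes> x \<in> J"
proof -
  obtain r s where c: "x \<in> carrier R" "r \<in> carrier R" "s \<in> carrier R"
    and e: "x \<oplus> r \<otimes> a = s \<otimes> a"
    using x by (elim principal_k_idealE)
  have J_mult: "b \<otimes> (q \<otimes> a) \<in> J" if "q \<in> carrier R" for q
    using semiring_idealD(4)[OF k_idealD(1)[OF J] that ba] that a b by (simp add: m_lcomm)
  have "b \<otimes> x \<oplus> b \<otimes> (r \<otimes> a) = b \<otimes> (s \<otimes> a)"
    using a b c by (simp flip: e add: r_distr)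
  then show ?thesis
    using k_idealD(2)[OF J, of "b \<otimes> x" "b \<otimes> (r \<otimes> a)"] J_mult a b c by simp
qed

lemma k_prime_ideal_mult_memD:
  assumes J: "k_prime_ideal J R" and a: "a \<in> carrier R" and b: "b \<in> carrier R"
    and ab: "a \<otimes> b \<in> J"
  shows "a \<in> J \<or> b \<in> J"
proof -
  have k: "k_ideal J R" using J by (simp add: k_prime_ideal_def)
  have "x \<otimes> y \<in> J" if x: "x \<in> principal_k_ideal R a" and y: "y \<in> principal_k_ideal R b" for x y
  proof -
    have c: "x \<in> carrier R" "y \<in> carrier R"
      using x y by (auto elim: principal_k_idealE)
    \<comment> \<open>The generators are replaced one at a time: first \<open>b\<close> by
      \<open>y\<close> with \<open>a\<close> as the fixed factor, then \<open>a\<close> by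
      \<open>x\<close> with \<open>y\<close> as the fixed factor. Commutativity brings the fixed
      factor to the left.\<close>
    have "a \<otimes> y \<in> J" by (rule principal_k_ideal_mult_mem[OF k b a y ab])
    then have "y \<otimes> a \<in> J" using a c by (simp add: m_comm)
    then have "y \<otimes> x \<in> J" by (rule principal_k_ideal_mult_mem[OF k a c(2) x])
    then show ?thesis using c by (simp add: m_comm)
  qed
  then have "principal_k_ideal R a \<cdot> principal_k_ideal R b \<subseteq> J"
    by (rule ideal_prod_subset_semiring_ideal[OF k_idealD(1)[OF k]])
  then have "principal_k_ideal R a \<subseteq> J \<or> principal_k_ideal R b \<subseteq> J"
    using J k_ideal_principal_k_ideal a b by (simp add: k_prime_ideal_def)
  then show ?thesis using generator_in_principal_k_ideal a b by blast
qed

text \<open>An ideal is only required to be nonempty; multiplying any of its elements by zero gives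
  zero.\<close>

lemma zero_in_k_ideal:
  assumes "k_ideal I R"
  shows "\<zero> \<in> I"
proof -
  obtain x where "x \<in> I" "x \<in> carrier R"
    using semiring_idealD(1,2)[OF k_idealD(1)[OF assms]] by blast
  then show ?thesis using semiring_idealD(4)[OF k_idealD(1)[OF assms], of \<zero> x] by simp
qed

end

lemma k_ideal_k_contraction:
  assumes "csemiring S" "csemiring S'" and h: "h \<in> semiring_hom S S'" and J: "k_ideal J S'"
  shows "k_ideal (k_contraction S h J) S"
proof -
  interpret S: csemiring S by fact
  interpret S': csemiring S' by fact
  have hom: "h \<in> ring_hom S S'" and zero: "h \<zero>\<^bsub>S\<^esub> = \<zero>\<^bsub>S'\<^esub>"
    using h by (auto simp: semiring_hom_def)
  \<comment> \<open>Nonemptiness of \<open>J\<close> alone does not give an element in the preimage,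
    since \<open>J\<close> could a priori miss the image of \<open>h\<close>. Preservation of zero
    settles this.\<close>
  have "\<zero>\<^bsub>S\<^esub> \<in> k_contraction S h J"
    using S'.zero_in_k_ideal[OF J] zero by (simp add: k_contraction_def)
  then have ne: "k_contraction S h J \<noteq> {}" by blast
  note mem = k_contraction_def ring_hom_closed[OF hom]
    ring_hom_add[OF hom] ring_hom_mult[OF hom]
  show ?thesis
    unfolding k_ideal_def semiring_ideal_def
  proof (intro conjI ballI impI)
    show "k_contraction S h J \<subseteq> carrier S" by (auto simp: k_contraction_def)
  next
    fix x y assume "x \<in> k_contraction S h J" "y \<in> k_contraction S h J"
    then show "x \<oplus>\<^bsub>S\<^esub> y \<in> k_contraction S h J"
      using semiring_idealD(3)[OF k_idealD(1)[OF J]] by (simp add: mem)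
  next
    fix r x assume "r \<in> carrier S" "x \<in> k_contraction S h J"
    then show "r \<otimes>\<^bsub>S\<^esub> x \<in> k_contraction S h J"
      using semiring_idealD(4)[OF k_idealD(1)[OF J]] by (simp add: mem)
  next
    fix x y assume "x \<in> carrier S" "y \<in> carrier S"
      "x \<oplus>\<^bsub>S\<^esub> y \<in> k_contraction S h J" "y \<in> k_contraction S h J"
    then show "x \<in> k_contraction S h J"
      using k_idealD(2)[OF J, of "h x" "h y"] by (simp add: mem)
  qed (fact ne)
qed

theorem proposition4p1:
  fixes S :: "('a, 'm) ring_scheme" and S' :: "('b, 'n) ring_scheme"
    and \<phi> :: "'a \<Rightarrow> 'b" and J :: "'b set"
  assumes "csemiring S" and "csemiring S'"
    and "\<phi> \<in> semiring_hom S S'"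
    and "k_prime_ideal J S'"
  shows "k_prime_ideal (k_contraction S \<phi> J) S"
proof (rule k_prime_idealI)
  show "k_ideal (k_contraction S \<phi> J) S"
    using assms by (intro k_ideal_k_contraction) (auto simp: k_prime_ideal_def)
next
  have hom: "\<phi> \<in> ring_hom S S'" using assms(3) by (simp add: semiring_hom_def)
  fix a b
  assume a: "a \<in> carrier S" and b: "b \<in> carrier S"
    and "a \<otimes>\<^bsub>S\<^esub> b \<in> k_contraction S \<phi> J"
  then have "\<phi> a \<otimes>\<^bsub>S'\<^esub> \<phi> b \<in> J"
    by (simp add: k_contraction_def ring_hom_mult[OF hom])
  \<comment> \<open>Primeness on elements is what transfers here: the image of a k-ideal of
    \<open>S\<close> need not be an ideal of \<open>S'\<close>, so k-primeness of \<open>J\<close>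
    could not be applied to images directly.\<close>
  then have "\<phi> a \<in> J \<or> \<phi> b \<in> J"
    using csemiring.k_prime_ideal_mult_memD[OF assms(2,4)] ring_hom_closed[OF hom] a b by blast
  then show "a \<in> k_contraction S \<phi> J \<or> b \<in> k_contraction S \<phi> J"
    using a b by (simp add: k_contraction_def)
qed

end
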